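(* Suppose that $p_n=\frac12-r_n$ for $n\ge1$, where $0\le r_n\le \frac12-\varepsilon$ for all $n\ge 1$, for some $\varepsilon>0$. Let $\{Z_n\}_{n\ge0}$ be the associated branching process with one immigrant per generation, and let $D(n)=1+\sum_{j=1}^n m_jm_{j+1}\cdots m_n$, where $m_j=(1-p_j)/p_j$. (1) If $\sum_{n=2}^\infty\frac{1}{D(n)\log n}<\infty$, then almost surely $\{Z_n\}$ has at most finitely many regeneration times. (2) If there exists some $\delta>0$ such that $D(n)\le \delta n\log n$ for all $n$ large enough, and $\sum_{n=2}^\infty\frac{1}{D(n)\log n}=\infty$, then for every integer $k\ge1$, almost surely $\{Z_n\}$ has infinitely many $k$-strong regeneration times.
   Context: For $k\ge1$ let $0<p_k\le 1/2$, $q_k=1-p_k$, and $f_k(s)=\frac{p_k}{1-q_ks}$ for $s\in[0,1]$ (a geometric probability generating function). Let $\{Z_n\}_{n\ge0}$ be a Markov chain with values in $\{0,1,2,\dots\}$ such that $Z_0=0$ and $$E\left(s^{Z_n}\mid Z_0,\dots,Z_{n-1}\right)=[f_n(s)]^{1+Z_{n-1}},\qquad n\ge1,\ s\in[0,1].$$ This is a branching process in varying environment with exactly one immigrant in each generation. Let $C=\{n\ge0: Z_n=0\}$ and, for $k\ge1$, $C_k=\{n\ge 0: n+i\in C \text{ for all } 0\le i\le k-1\}$. If $n\in C$, then $n$ is called a regeneration time of $\{Z_n\}$; if $n\in C_k$, then $n$ is called a $k$-strong regeneration time of $\{Z_n\}$. *)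

theory Defs
  imports "HOL-Probability.Probability"
begin

definition geom_pgf :: "(nat \<Rightarrow> real) \<Rightarrow> nat \<Rightarrow> real \<Rightarrow> real" where
  "geom_pgf p k s = p k / (1 - (1 - p k) * s)"

text \<open>The sigma-algebra generated by \<open>Z 0, \<dots>, Z (n - 1)\<close>.\<close>
definition past_algebra :: "'a measure \<Rightarrow> (nat \<Rightarrow> 'a \<Rightarrow> nat) \<Rightarrow> nat \<Rightarrow> 'a measure" where
  "past_algebra M Z n =
     sigma (space M) (\<Union>i\<in>{..<n}. {Z i -` A \<inter> space M | A. A \<in> UNIV})"

text \<open>
  Branching process in varying environment with one immigrant per generation. The
  parameter \<open>p 0\<close> is not used. The Markov property needs no separate assumption: by
  \<open>cond_pgf\<close> the conditional law of \<open>Z n\<close> given the whole past has a generating function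
  which depends on \<open>Z (n - 1)\<close> only. At \<open>s = 0\<close> the convention \<open>0 ^ 0 = 1\<close> makes
  \<open>s ^ Z n\<close> the indicator of \<open>Z n = 0\<close>.
\<close>
locale branching_immigration = prob_space M
  for M :: "'a measure" and p :: "nat \<Rightarrow> real" and Z :: "nat \<Rightarrow> 'a \<Rightarrow> nat" +
  assumes p_range: "\<And>k. k \<ge> 1 \<Longrightarrow> 0 < p k \<and> p k \<le> 1/2"
    and Z_measurable: "\<And>n. Z n \<in> measurable M (count_space UNIV)"
    and Z_0: "AE \<omega> in M. Z 0 \<omega> = 0"
    and cond_pgf: "\<And>n s. n \<ge> 1 \<Longrightarrow> s \<in> {0..1} \<Longrightarrow>
      AE \<omega> in M. real_cond_exp M (past_algebra M Z n) (\<lambda>\<omega>. s ^ Z n \<omega>) \<omega>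
                  = geom_pgf p n s ^ (1 + Z (n - 1) \<omega>)"

definition regeneration_times :: "(nat \<Rightarrow> 'a \<Rightarrow> nat) \<Rightarrow> 'a \<Rightarrow> nat set" where
  "regeneration_times Z \<omega> = {n. Z n \<omega> = 0}"

definition strong_regeneration_times :: "nat \<Rightarrow> (nat \<Rightarrow> 'a \<Rightarrow> nat) \<Rightarrow> 'a \<Rightarrow> nat set" where
  "strong_regeneration_times k Z \<omega> = {n. \<forall>i<k. n + i \<in> regeneration_times Z \<omega>}"

definition offspring_mean :: "(nat \<Rightarrow> real) \<Rightarrow> nat \<Rightarrow> real" where
  "offspring_mean p j = (1 - p j) / p j"

definition D :: "(nat \<Rightarrow> real) \<Rightarrow> nat \<Rightarrow> real" where
  "D p n = 1 + (\<Sum>j=1..n. \<Prod>i=j..n. offspring_mean p i)"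

end

theory Submission
  imports Defs
begin

text \<open>
  With \<open>x n = 1 / (m 1 \<cdots> m n)\<close> (\<open>inv_mean\<close>), a process that is at 0 at time \<open>m\<close> is geometric
  at time \<open>n\<close>, and is at 0 with probability \<open>1 / D(m,n)\<close>, where
  \<open>D(m,n) = (x m + \<dots> + x n) / x n\<close> (\<open>D_from\<close>) and \<open>D(0,n) = D(n)\<close>. Zeros at \<open>n\<close> are counted
  with weight \<open>1 / ln n\<close>.

  Convergence: if \<open>x\<close> loses less than half of its value between \<open>m\<close> and \<open>m + sqrt m\<close>, then
  \<open>D(m,n) \<le> 2 (n - m + 1)\<close> on this window, so a zero at \<open>m\<close> entails a weighted number of later
  zeros whose mean is bounded below; since the total weighted number of zeros has finite mean,
  there are finitely many such \<open>m\<close>. At the remaining times \<open>m\<close> the sum of \<open>1 / D(m)\<close> is finite,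
  and the Borel--Cantelli lemma applies.

  Divergence: the partial sums \<open>x 0 + \<dots> + x n\<close> grow by any fixed factor between \<open>m\<close> and a
  power of \<open>m\<close>. Beyond that power the strong regenerations at \<open>m\<close> and \<open>n\<close> are nearly
  independent; below it \<open>D(m,n) \<ge> n - m + 1\<close> bounds the weighted number of regenerations
  following one at \<open>m\<close>. The second moment method then gives probability one.
\<close>

section \<open>Deterministic facts on the products \<open>inv_mean\<close>, their partial sums and
  \<open>D\<close>\<close>

definition inv_mean :: "(nat \<Rightarrow> real) \<Rightarrow> nat \<Rightarrow> real" where
  "inv_mean p n = (\<Prod>i=1..n. 1 / offspring_mean p i)"

definition inv_mean_sum :: "(nat \<Rightarrow> real) \<Rightarrow> nat \<Rightarrow> real" where
  "inv_mean_sum p n = (\<Sum>j=0..n. inv_mean p j)"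

definition D_from :: "(nat \<Rightarrow> real) \<Rightarrow> nat \<Rightarrow> nat \<Rightarrow> real" where
  "D_from p m n = (\<Sum>j=m..n. inv_mean p j) / inv_mean p n"

locale slow_environment =
  fixes p :: "nat \<Rightarrow> real"
  assumes p_bounds: "\<And>k. k \<ge> 1 \<Longrightarrow> 0 < p k \<and> p k \<le> 1/2"
begin

lemma offspring_mean_ge_1: "k \<ge> 1 \<Longrightarrow> offspring_mean p k \<ge> 1"
  using p_bounds[of k] by (simp add: offspring_mean_def field_simps)

lemma inv_mean_0: "inv_mean p 0 = 1"
  by (simp add: inv_mean_def)

lemma inv_mean_Suc: "inv_mean p (Suc n) = inv_mean p n / offspring_mean p (Suc n)"
  by (simp add: inv_mean_def)

lemma inv_mean_pos: "inv_mean p n > 0"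
proof (induction n)
  case (Suc n)
  then show ?case
    using offspring_mean_ge_1[of "Suc n"] by (simp add: inv_mean_Suc)
qed (simp add: inv_mean_0)

lemma decseq_inv_mean: "decseq (inv_mean p)"
proof (rule decseq_SucI)
  fix n
  show "inv_mean p (Suc n) \<le> inv_mean p n"
    using offspring_mean_ge_1[of "Suc n"] inv_mean_pos[of n]
    by (simp add: inv_mean_Suc divide_le_eq)
qed

lemma inv_mean_antimono: "m \<le> n \<Longrightarrow> inv_mean p n \<le> inv_mean p m"
  using decseq_inv_mean by (simp add: decseq_def)

lemma inv_mean_le_1: "inv_mean p n \<le> 1"
  using inv_mean_antimono[of 0 n] by (simp add: inv_mean_0)

lemma inv_mean_sum_Suc: "inv_mean_sum p (Suc n) = inv_mean_sum p n + inv_mean p (Suc n)"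
  by (simp add: inv_mean_sum_def)

lemma inv_mean_sum_mono: "m \<le> n \<Longrightarrow> inv_mean_sum p m \<le> inv_mean_sum p n"
  unfolding inv_mean_sum_def by (intro sum_mono2) (auto intro: less_imp_le inv_mean_pos)

lemma inv_mean_sum_ge_1: "inv_mean_sum p n \<ge> 1"
  using inv_mean_sum_mono[of 0 n] by (simp add: inv_mean_sum_def inv_mean_0)

lemma inv_mean_sum_pos: "inv_mean_sum p n > 0"
  using inv_mean_sum_ge_1[of n] by linarith

text \<open>Each of the \<open>k\<close> added terms is at most 1, while the sum up to
  \<open>m\<close> is at least 1. Thus replacing \<open>m\<close> by the end of a block of zeros
  that starts at \<open>m\<close> costs only a constant factor.\<close>

lemma inv_mean_sum_add_le: "inv_mean_sum p (m + k) \<le> (1 + real k) * inv_mean_sum p m"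
proof -
  have "inv_mean_sum p (m + k) \<le> inv_mean_sum p m + real k"
  proof (induction k)
    case (Suc k)
    then show ?case using inv_mean_le_1[of "m + Suc k"] by (simp add: inv_mean_sum_Suc)
  qed simp
  moreover have "real k * 1 \<le> real k * inv_mean_sum p m"
    by (intro mult_left_mono inv_mean_sum_ge_1) simp
  ultimately show ?thesis by (simp add: algebra_simps)
qed

lemma D_from_self: "D_from p m m = 1"
  using inv_mean_pos[of m] by (simp add: D_from_def)

text \<open>This is the recursion of \<open>D\<close>, started at \<open>m\<close>; the generating
  functions follow it in \<open>pgf_from_zero\<close>.\<close>

lemma D_from_Suc:
  assumes "m \<le> n"
  shows "D_from p m (Suc n) = 1 + offspring_mean p (Suc n) * D_from p m n"
  using assms inv_mean_pos[of n] offspring_mean_ge_1[of "Suc n"]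
  by (simp add: D_from_def inv_mean_Suc field_simps)

lemma D_0: "D p 0 = 1"
  by (simp add: D_def)

lemma D_Suc: "D p (Suc n) = 1 + offspring_mean p (Suc n) * D p n"
  by (simp add: D_def algebra_simps sum_distrib_left)

lemma D_eq_D_from: "D p n = D_from p 0 n"
  by (induction n) (simp_all add: D_0 D_Suc D_from_self D_from_Suc)

lemma D_eq: "D p n = inv_mean_sum p n / inv_mean p n"
  by (simp add: D_eq_D_from D_from_def inv_mean_sum_def)

text \<open>As \<open>inv_mean p\<close> is nonincreasing, every term of the sum is at least the
  last one, by which the sum is divided.\<close>

lemma D_from_ge:
  assumes "m \<le> n"
  shows "real (n - m + 1) \<le> D_from p m n"
proof -
  have "real (n - m + 1) * inv_mean p n = (\<Sum>j=m..n. inv_mean p n)"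
    using assms by (simp add: Suc_diff_le)
  also have "\<dots> \<le> (\<Sum>j=m..n. inv_mean p j)"
    by (intro sum_mono inv_mean_antimono) auto
  finally show ?thesis
    using inv_mean_pos[of n] by (simp add: D_from_def pos_le_divide_eq)
qed

lemma D_from_pos: "m \<le> n \<Longrightarrow> D_from p m n > 0"
  using D_from_ge[of m n] by linarith

lemma D_pos: "D p n > 0"
  by (simp add: D_eq_D_from D_from_pos)

lemma D_from_ge_diff:
  assumes "m \<le> n"
  shows "D_from p m n \<ge> (inv_mean_sum p n - inv_mean_sum p m) / inv_mean p n"
proof -
  have "inv_mean_sum p n = (\<Sum>j=0..<m. inv_mean p j) + (\<Sum>j=m..n. inv_mean p j)"
    using assms by (simp add: inv_mean_sum_def sum.atLeastLessThan_concat flip: atLeastLessThanSuc_atLeastAtMost)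
  also have "(\<Sum>j=0..<m. inv_mean p j) \<le> inv_mean_sum p m"
    unfolding inv_mean_sum_def by (intro sum_mono2) (auto intro: less_imp_le inv_mean_pos)
  finally show ?thesis
    using inv_mean_pos[of n] by (simp add: D_from_def divide_right_mono)
qed

end


section \<open>Generating functions and the probability of a zero\<close>

sublocale branching_immigration \<subseteq> slow_environment p
  by unfold_locales (rule p_range)

context branching_immigration
begin

definition zero_at :: "nat \<Rightarrow> 'a set" where
  "zero_at n = {\<omega> \<in> space M. Z n \<omega> = 0}"

lemma past_generators:
  "(\<Union>i\<in>{..<n}. {Z i -` A \<inter> space M | A. A \<in> UNIV}) \<subseteq> Pow (space M)"
  by auto

lemma sets_past:
  "sets (past_algebra M Z n) = sigma_sets (space M) (\<Union>i\<in>{..<n}. {Z i -` A \<inter> space M | A. A \<in> UNIV})"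
  unfolding past_algebra_def by (rule sets_measure_of[OF past_generators])

lemma space_past [simp]: "space (past_algebra M Z n) = space M"
  unfolding past_algebra_def by (rule space_measure_of[OF past_generators])

lemma subalgebra_past: "subalgebra M (past_algebra M Z n)"
  unfolding subalgebra_def
proof
  show "sets (past_algebra M Z n) \<subseteq> sets M"
    unfolding sets_past
    by (rule sets.sigma_sets_subset) (auto intro: measurable_sets[OF Z_measurable])
qed simp

lemma past_mono: "m \<le> n \<Longrightarrow> sets (past_algebra M Z m) \<subseteq> sets (past_algebra M Z n)"
  unfolding sets_past by (rule sigma_sets_mono') (auto intro: order.strict_trans2)

lemma zero_at_past: "i < n \<Longrightarrow> zero_at i \<in> sets (past_algebra M Z n)"
  unfolding sets_past
proof (rule sigma_sets.Basic)
  have "zero_at i = Z i -` {0} \<inter> space M" by (auto simp: zero_at_def)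
  then show "i < n \<Longrightarrow> zero_at i \<in> (\<Union>i\<in>{..<n}. {Z i -` A \<inter> space M | A. A \<in> UNIV})"
    by blast
qed

lemma past_events: "E \<in> sets (past_algebra M Z n) \<Longrightarrow> E \<in> events"
  using subalgebra_past by (auto simp: subalgebra_def)

lemma zero_at_events [measurable]: "zero_at n \<in> events"
  using past_events[OF zero_at_past[OF lessI]] .

lemma integrable_power_Z:
  assumes "s \<in> {0..1::real}"
  shows "integrable M (\<lambda>\<omega>. s ^ Z n \<omega>)"
proof (rule integrable_const_bound[where B = 1])
  note [measurable] = Z_measurable
  show "(\<lambda>\<omega>. s ^ Z n \<omega>) \<in> borel_measurable M" by measurable
qed (use assms in \<open>auto intro: power_le_one\<close>)

text \<open>The right side is \<open>prob E\<close> times the generating function of a geometric law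
  with success probability \<open>1 / D_from p m n\<close>. Conditioning on the past replaces
  \<open>s ^ Z (Suc n)\<close> by \<open>t * t ^ Z n\<close> with
  \<open>t = geom_pgf p (Suc n) s\<close>, and geometric laws are preserved. A general
  \<open>E\<close> known at time \<open>m\<close> expresses that the process starts afresh at a
  zero; first zeros and blocks of zeros are later taken for \<open>E\<close>.\<close>

lemma pgf_from_zero:
  assumes "m \<le> n" and E: "E \<in> sets (past_algebra M Z (Suc m))" "E \<subseteq> zero_at m"
    and "s \<in> {0..1}"
  shows "(LINT \<omega>|M. indicator E \<omega> * s ^ Z n \<omega>) = prob E / (1 + (D_from p m n - 1) * (1 - s))"
  using assms(1,4)
proof (induction n arbitrary: s rule: dec_induct)
  case base
  have "(LINT \<omega>|M. indicator E \<omega> * s ^ Z m \<omega>) = (LINT \<omega>|M. indicator E \<omega>)"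
    using E(2) by (intro Bochner_Integration.integral_cong) (auto simp: zero_at_def indicator_def)
  also have "\<dots> = prob E"
    using past_events[OF E(1)] by simp
  finally show ?case by (simp add: D_from_self)
next
  case (step n)
  define q where "q = 1 - p (Suc n)"
  define t where "t = geom_pgf p (Suc n) s"
  have p: "0 < p (Suc n)" "p (Suc n) \<le> 1/2" using p_range[of "Suc n"] by auto
  have qs: "q * s \<le> q" using p step.prems by (simp add: q_def mult_left_le)
  then have den: "1 - q * s \<ge> p (Suc n)" by (simp add: q_def)
  have t: "t \<in> {0..1}" using den p by (simp add: t_def geom_pgf_def flip: q_def)
  interpret F: finite_measure_subalgebra M "past_algebra M Z (Suc n)"
    by unfold_locales (rule subalgebra_past)
  have E': "E \<in> sets (past_algebra M Z (Suc n))"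
    using E(1) past_mono[of "Suc m" "Suc n"] step.hyps by auto
  have "(LINT \<omega>|M. indicator E \<omega> * s ^ Z (Suc n) \<omega>)
      = (LINT \<omega>|M. indicator E \<omega> * real_cond_exp M (past_algebra M Z (Suc n)) (\<lambda>\<omega>. s ^ Z (Suc n) \<omega>) \<omega>)"
    using F.real_cond_exp_intA[OF integrable_power_Z[OF step.prems] E']
    by (simp add: set_lebesgue_integral_def)
  also have "\<dots> = (LINT \<omega>|M. t * (indicator E \<omega> * t ^ Z n \<omega>))"
  proof (rule integral_cong_AE)
    note [measurable] = Z_measurable past_events[OF E']
    show "(\<lambda>\<omega>. t * (indicator E \<omega> * t ^ Z n \<omega>)) \<in> borel_measurable M" by measurable
    show "(\<lambda>\<omega>. indicator E \<omega> * real_cond_exp M (past_algebra M Z (Suc n)) (\<lambda>\<omega>. s ^ Z (Suc n) \<omega>) \<omega>)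
        \<in> borel_measurable M" by measurable
    show "AE \<omega> in M. indicator E \<omega> * real_cond_exp M (past_algebra M Z (Suc n)) (\<lambda>\<omega>. s ^ Z (Suc n) \<omega>) \<omega>
        = t * (indicator E \<omega> * t ^ Z n \<omega>)"
      using cond_pgf[of "Suc n" s] step.prems by (auto simp: t_def elim!: AE_mp)
  qed
  also have "\<dots> = t * (prob E / (1 + (D_from p m n - 1) * (1 - t)))"
    using step.IH[OF t] by simp
  also have "\<dots> = prob E / (1 + (D_from p m (Suc n) - 1) * (1 - s))"
  proof -
    let ?d = "D_from p m n" and ?p = "p (Suc n)"
    have cancel: "t * (e / a) = e / b" if "a > 0" "b > 0" "t * b = a" for a b e :: real
      using that by (auto simp: divide_simps)
    have d: "?d \<ge> 1" using D_from_ge[OF step.hyps(1)] by simp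
    have 1: "t = ?p / (1 - q * s)" by (simp add: t_def geom_pgf_def q_def)
    have den0: "1 - q * s > 0" using den p by linarith
    have "1 + (?d - 1) * (1 - t) > 0" using d t
      by (intro add_pos_nonneg mult_nonneg_nonneg) auto
    moreover have "1 + q / ?p * ?d * (1 - s) > 0"
      using d p step.prems by (intro add_pos_nonneg mult_nonneg_nonneg) (auto simp: q_def)
    \<comment> \<open>Since \<open>1 - t = q * (1 - s) / (1 - q * s)\<close>, both sides equal
      \<open>(?p + q * ?d * (1 - s)) / (1 - q * s)\<close>.\<close>
    moreover have "t * (1 + q / ?p * ?d * (1 - s)) = 1 + (?d - 1) * (1 - t)"
      using den0 p(1) unfolding 1 by (simp add: field_simps) (simp add: q_def algebra_simps)
    ultimately have "t * (prob E / (1 + (?d - 1) * (1 - t))) = prob E / (1 + q / ?p * ?d * (1 - s))"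
      by (rule cancel)
    also have "q / ?p * ?d = D_from p m (Suc n) - 1"
      using step.hyps(1) by (simp add: D_from_Suc offspring_mean_def q_def)
    finally show ?thesis .
  qed
  finally show ?case .
qed

text \<open>The generating function is evaluated at 0, where \<open>0 ^ Z n\<close> is the indicator
  of \<open>zero_at n\<close>.\<close>

lemma prob_zero_at_from:
  assumes "m \<le> n" and E: "E \<in> sets (past_algebra M Z (Suc m))" "E \<subseteq> zero_at m"
  shows "prob (E \<inter> zero_at n) = prob E / D_from p m n"
proof -
  have "prob (E \<inter> zero_at n) = (LINT \<omega>|M. indicator (E \<inter> zero_at n) \<omega>)"
    using past_events[OF E(1)] by simp
  also have "\<dots> = (LINT \<omega>|M. indicator E \<omega> * 0 ^ Z n \<omega>)"
    by (intro Bochner_Integration.integral_cong) (auto simp: zero_at_def indicator_def)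
  finally show ?thesis
    using pgf_from_zero[OF assms, of 0] by simp
qed

lemma prob_zero_at: "prob (zero_at n) = 1 / D p n"
proof -
  have 0: "AE \<omega> in M. \<omega> \<in> zero_at 0"
    using Z_0 by (auto simp: zero_at_def elim: AE_mp)
  have "prob (zero_at 0 \<inter> zero_at n) = prob (zero_at 0) / D_from p 0 n"
    by (rule prob_zero_at_from) (auto intro: zero_at_past)
  moreover have "prob (zero_at 0) = 1"
    using 0 by (simp add: prob_eq_1)
  moreover have "prob (zero_at 0 \<inter> zero_at n) = prob (zero_at n)"
    using 0 by (intro measure_eq_AE) (auto elim: AE_mp)
  ultimately show ?thesis by (simp add: D_eq_D_from)
qed

end

section \<open>Flat times and deterministic estimates for the convergence half\<close>

context slow_environment
begin

text \<open>The length \<open>sqrt m\<close> is long enough for a harmonic sum over the window to be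
  comparable to \<open>ln m\<close>, and short enough that the number of windows over an index
  offsets the factor \<open>1 / sqrt (m + 1)\<close> in \<open>inverse_D_le\<close>.\<close>

definition window :: "nat \<Rightarrow> nat" where
  "window m = nat \<lfloor>sqrt (real m)\<rfloor>"

definition flat :: "nat \<Rightarrow> bool" where
  "flat m \<longleftrightarrow> inv_mean p m \<le> 2 * inv_mean p (m + window m)"

lemma window_le_sqrt: "real (window m) \<le> sqrt (real m)"
  by (simp add: window_def)

lemma sqrt_less_window: "sqrt (real m) < real (window m) + 1"
  unfolding window_def by simp

lemma window_le: "window m \<le> m"
proof (cases "m = 0")
  case False
  have "real (window m) \<le> sqrt (real m)" by (rule window_le_sqrt)
  also have "\<dots> \<le> sqrt (real m * real m)" using False by (intro real_sqrt_le_mono) simp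
  finally show ?thesis by simp
qed (simp add: window_def)

lemma window_mono: "m \<le> n \<Longrightarrow> window m \<le> window n"
  unfolding window_def by (intro nat_mono floor_mono) simp

text \<open>The sum \<open>inv_mean_sum p m\<close> is at least 1 and at least
  \<open>(m + 1) * inv_mean p m\<close>, hence at least the square root of the latter.\<close>

lemma inverse_D_le: "1 / D p m \<le> sqrt (inv_mean p m) / sqrt (real m + 1)"
proof -
  have "(real m + 1) * inv_mean p m \<le> inv_mean_sum p m"
    using D_from_ge[of 0 m] inv_mean_pos[of m]
    by (simp add: D_from_def inv_mean_sum_def pos_le_divide_eq add.commute)
  also have "\<dots> \<le> (inv_mean_sum p m)\<^sup>2"
    using inv_mean_sum_ge_1[of m] by (simp add: power2_eq_square)
  finally have "sqrt ((real m + 1) * inv_mean p m) \<le> inv_mean_sum p m"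
    using inv_mean_sum_pos[of m] by (intro real_le_lsqrt) auto
  then have "inv_mean p m / inv_mean_sum p m \<le> inv_mean p m / sqrt ((real m + 1) * inv_mean p m)"
    using inv_mean_pos[of m] by (intro divide_left_mono mult_pos_pos inv_mean_sum_pos) auto
  also have "\<dots> = inv_mean p m / sqrt (inv_mean p m) / sqrt (real m + 1)"
    by (simp add: real_sqrt_mult mult.commute)
  also have "inv_mean p m / sqrt (inv_mean p m) = sqrt (inv_mean p m)"
    using inv_mean_pos[of m] by (simp add: real_div_sqrt)
  finally show ?thesis
    by (simp add: D_eq)
qed

text \<open>At most \<open>sqrt i\<close> of the windows contain \<open>i\<close>, and
  \<open>i < 2 * m\<close> bounds each weight by \<open>2 / sqrt (i + 1)\<close>.\<close>

lemma sum_window_weights: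
  "(\<Sum>m | m < N \<and> m \<le> i \<and> i < m + window m. 1 / sqrt (real m + 1)) \<le> 2"
proof -
  let ?S = "{m. m < N \<and> m \<le> i \<and> i < m + window m}"
  \<comment> \<open>By monotonicity \<open>i < m + window m\<close> and \<open>m \<le> i\<close>
    give \<open>i < m + window i\<close>.\<close>
  have sub: "?S \<subseteq> {i + 1 - window i..<i + 1}"
    using window_mono[of _ i] by force
  have "(\<Sum>m\<in>?S. 1 / sqrt (real m + 1)) \<le> (\<Sum>m\<in>?S. 2 / sqrt (real i + 1))"
  proof (intro sum_mono)
    fix m assume "m \<in> ?S"
    then have "i < 2 * m" using window_le[of m] by simp
    then have "sqrt (real i + 1) \<le> sqrt (2\<^sup>2 * (real m + 1))"
      by (intro real_sqrt_le_mono) simp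
    also have "\<dots> = 2 * sqrt (real m + 1)"
      by (simp only: real_sqrt_mult real_sqrt_abs)
    finally have "sqrt (real i + 1) \<le> 2 * sqrt (real m + 1)" .
    then show "1 / sqrt (real m + 1) \<le> 2 / sqrt (real i + 1)"
      by (simp add: field_simps)
  qed
  also have "\<dots> = real (card ?S) * (2 / sqrt (real i + 1))"
    by simp
  also have "\<dots> \<le> sqrt (real i + 1) * (2 / sqrt (real i + 1))"
  proof (intro mult_right_mono)
    have "card ?S \<le> window i"
      using card_mono[OF _ sub] by simp
    then have "real (card ?S) \<le> sqrt (real i)"
      using window_le_sqrt[of i] by linarith
    also have "\<dots> \<le> sqrt (real i + 1)" by simp
    finally show "real (card ?S) \<le> sqrt (real i + 1)" .
  qed simp
  also have "\<dots> = 2" by simp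
  finally show ?thesis .
qed

text \<open>
  Each time that is not flat costs a fixed fraction of \<open>sqrt (inv_mean p m)\<close>, and the windows
  cover each index about \<open>sqrt m\<close> times, so the sum is controlled by a telescoping one.
\<close>
lemma summable_not_flat: "summable (\<lambda>m. of_bool (\<not> flat m) / D p m)"
proof (rule summableI_nonneg_bounded)
  show "0 \<le> of_bool (\<not> flat m) / D p m" for m
    using D_pos[of m] by simp
next
  fix N
  define y where "y m = sqrt (inv_mean p m)" for m
  have y_mono: "m \<le> n \<Longrightarrow> y n \<le> y m" for m n
    by (simp add: y_def inv_mean_antimono)
  have "(\<Sum>m<N. of_bool (\<not> flat m) / D p m)
      \<le> (\<Sum>m<N. 4 * ((\<Sum>i\<in>{m..<m + window m}. y i - y (Suc i)) / sqrt (real m + 1)))"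
  proof (intro sum_mono)
    fix m
    have tel: "(\<Sum>i\<in>{m..<m + window m}. y i - y (Suc i)) = y m - y (m + window m)"
      using sum_Suc_diff'[of m "m + window m" "\<lambda>i. - y i"] by simp
    have "of_bool (\<not> flat m) * y m \<le> 4 * (y m - y (m + window m))"
    proof (cases "flat m")
      case False
      \<comment> \<open>Here \<open>1/2\<close> is relaxed to \<open>9/16\<close>, a perfect square:
        \<open>y\<close> then loses at least a quarter of its value over the window, whence the
        factor 4.\<close>
      then have "inv_mean p (m + window m) \<le> (3/4)\<^sup>2 * inv_mean p m"
        using inv_mean_pos[of m] by (simp add: flat_def power2_eq_square)
      then have "y (m + window m) \<le> sqrt ((3/4)\<^sup>2 * inv_mean p m)"
        unfolding y_def by (rule real_sqrt_le_mono)
      then show ?thesis using False by (simp add: y_def real_sqrt_mult)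
    qed (use y_mono in simp)
    moreover have "of_bool (\<not> flat m) / D p m \<le> of_bool (\<not> flat m) * y m / sqrt (real m + 1)"
      using inverse_D_le[of m] by (simp add: y_def)
    ultimately have "of_bool (\<not> flat m) / D p m \<le> 4 * (y m - y (m + window m)) / sqrt (real m + 1)"
      by (elim order.trans) (intro divide_right_mono, auto)
    then show "of_bool (\<not> flat m) / D p m
        \<le> 4 * ((\<Sum>i\<in>{m..<m + window m}. y i - y (Suc i)) / sqrt (real m + 1))"
      unfolding tel by simp
  qed
  \<comment> \<open>Because \<open>window m \<le> m\<close>, all indices stay below
    \<open>2 * N\<close>, and the two sums can be exchanged.\<close>
  also have "\<dots> = 4 * (\<Sum>m<N. \<Sum>i | i < 2 * N \<and> m \<le> i \<and> i < m + window m.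
      (y i - y (Suc i)) * (1 / sqrt (real m + 1)))"
  proof -
    have "{m..<m + window m} = {i. i < 2 * N \<and> m \<le> i \<and> i < m + window m}" if "m < N" for m
      using that window_le[of m] by auto
    then show ?thesis
      by (simp add: sum_distrib_left sum_divide_distrib)
  qed
  also have "(\<Sum>m<N. \<Sum>i | i < 2 * N \<and> m \<le> i \<and> i < m + window m.
      (y i - y (Suc i)) * (1 / sqrt (real m + 1)))
    = (\<Sum>i<2*N. \<Sum>m | m < N \<and> m \<le> i \<and> i < m + window m.
      (y i - y (Suc i)) * (1 / sqrt (real m + 1)))"
    using sum.swap_restrict[of "{..<N}" "{..<2*N}"
        "\<lambda>m i. (y i - y (Suc i)) * (1 / sqrt (real m + 1))" "\<lambda>m i. m \<le> i \<and> i < m + window m"]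
    by simp
  also have "\<dots> \<le> (\<Sum>i<2*N. (y i - y (Suc i)) * 2)"
    unfolding sum_distrib_left[symmetric]
    by (intro sum_mono mult_left_mono sum_window_weights) (simp add: y_mono)
  also have "\<dots> = 2 * (y 0 - y (2 * N))"
    unfolding sum_distrib_right[symmetric] sum_lessThan_telescope' by simp
  also have "\<dots> \<le> 2"
    by (simp add: y_def inv_mean_0 inv_mean_pos less_imp_le)
  finally show "(\<Sum>m<N. of_bool (\<not> flat m) / D p m) \<le> 4 * 2" by simp
qed

text \<open>On the window of a flat \<open>m\<close>,
  \<open>D_from p m (m + k) \<le> 2 * (k + 1)\<close> and \<open>ln (m + k) \<le> 2 * ln m\<close>.
  The sum is therefore at least \<open>harm (window m + 1) / (4 * ln m)\<close>, and this harmonic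
  number is at least \<open>ln (sqrt m)\<close>, half of \<open>ln m\<close>.\<close>

lemma sum_flat_ge:
  assumes "flat m" "m \<ge> 2"
  shows "(\<Sum>n=m..m + window m. 1 / ln (real n) / D_from p m n) \<ge> 1 / 8"
proof -
  have lnm: "ln (real m) > 0" using assms(2) by simp
  have "1 / 8 = (1 / 2 * ln (real m)) / (4 * ln (real m))"
    using lnm by simp
  also have "\<dots> = ln (sqrt (real m)) / (4 * ln (real m))"
    using assms(2) by (simp add: ln_sqrt)
  also have "\<dots> \<le> harm (window m + 1) / (4 * ln (real m))"
  proof (intro divide_right_mono)
    have "ln (sqrt (real m)) \<le> ln (real (window m + 1) + 1)"
      using assms(2) sqrt_less_window[of m] by (subst ln_le_cancel_iff) auto
    also have "\<dots> \<le> harm (window m + 1)"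
      by (rule ln_le_harm)
    finally show "ln (sqrt (real m)) \<le> harm (window m + 1)" .
  qed (use lnm in simp)
  also have "\<dots> = (\<Sum>k<window m + 1. 1 / (2 * ln (real m)) / (2 * (real k + 1)))"
    unfolding harm_altdef sum_divide_distrib
    by (intro sum.cong refl) (simp add: field_simps)
  also have "\<dots> \<le> (\<Sum>k<window m + 1. 1 / ln (real (m + k)) / D_from p m (m + k))"
  proof (intro sum_mono)
    fix k assume "k \<in> {..<window m + 1}"
    then have k: "k \<le> window m" by simp
    have "ln (real (m + k)) \<le> ln (real m * real m)"
    proof (subst ln_le_cancel_iff)
      have "m + k \<le> m * 2" using k window_le[of m] by simp
      also have "\<dots> \<le> m * m" using assms(2) by (intro mult_left_mono) auto
      finally show "real (m + k) \<le> real m * real m"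
        by (metis of_nat_mono of_nat_mult)
    qed (use assms in auto)
    then have 1: "ln (real (m + k)) \<le> 2 * ln (real m)"
      using assms(2) by (simp add: ln_mult)
    have 2: "ln (real (m + k)) > 0" using assms(2) by (intro ln_gt_zero) linarith
    have "(\<Sum>j=m..m + k. inv_mean p j) \<le> (\<Sum>j=m..m + k. 2 * inv_mean p (m + k))"
    proof (intro sum_mono)
      fix j assume "j \<in> {m..m + k}"
      then have "inv_mean p j \<le> inv_mean p m" by (intro inv_mean_antimono) simp
      also have "\<dots> \<le> 2 * inv_mean p (m + window m)" using assms(1) by (simp add: flat_def)
      also have "\<dots> \<le> 2 * inv_mean p (m + k)" using k inv_mean_antimono[of "m + k" "m + window m"] by simp
      finally show "inv_mean p j \<le> 2 * inv_mean p (m + k)" .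
    qed
    also have "\<dots> = 2 * (real k + 1) * inv_mean p (m + k)"
      by simp
    finally have 3: "D_from p m (m + k) \<le> 2 * (real k + 1)"
      using inv_mean_pos[of "m + k"] by (simp add: D_from_def pos_divide_le_eq)
    show "1 / (2 * ln (real m)) / (2 * (real k + 1)) \<le> 1 / ln (real (m + k)) / D_from p m (m + k)"
      using 1 2 3 D_from_pos[of m "m + k"] by (intro frac_le) auto
  qed
  also have "\<dots> = (\<Sum>n=m..m + window m. 1 / ln (real n) / D_from p m n)"
    by (rule sum.reindex_bij_witness[of _ "\<lambda>n. n - m" "\<lambda>k. m + k"]) auto
  finally show ?thesis .
qed

end

section \<open>The convergence half: finitely many regeneration times\<close>

context branching_immigration
begin

text \<open>
  Decompose along the first zero in \<open>G\<close> after time \<open>N\<close>: from each such zero the conditional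
  expectation of the weighted number of later zeros is at least \<open>c\<close>.
\<close>
lemma prob_zero_in_le:
  assumes w: "\<And>n. w n \<ge> 0" and "c > 0"
    and G: "\<And>m. m \<in> G \<Longrightarrow> N \<le> m \<Longrightarrow> m \<le> R \<Longrightarrow> c \<le> (\<Sum>n=m..h m. w n / D_from p m n)"
    and sums: "summable (\<lambda>n. w n / D p n)"
  shows "c * prob (\<Union>m\<in>G \<inter> {N..R}. zero_at m) \<le> (\<Sum>n. w (n + N) / D p (n + N))"
proof -
  \<comment> \<open>The sets \<open>E m\<close> say that \<open>m\<close> is the first zero in
    \<open>G\<close> from \<open>N\<close> on. They are disjoint and known at time \<open>m\<close>,
    so \<open>prob_zero_at_from\<close> applies to each.\<close>
  define E where "E m = zero_at m - (\<Union>j\<in>G \<inter> {N..<m}. zero_at j)" for m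
  have E_past: "E m \<in> sets (past_algebra M Z (Suc m))" for m
    unfolding E_def by (intro sets.Diff sets.finite_UN zero_at_past) auto
  have E_zero: "E m \<subseteq> zero_at m" for m by (auto simp: E_def)
  note E_events = past_events[OF E_past]
  have E_union: "(\<Union>m\<in>G \<inter> {N..R}. zero_at m) = (\<Union>m\<in>G \<inter> {N..R}. E m)"
  proof (intro equalityI subsetI)
    fix \<omega> assume "\<omega> \<in> (\<Union>m\<in>G \<inter> {N..R}. zero_at m)"
    then obtain m0 where m0: "m0 \<in> G \<inter> {N..R} \<and> \<omega> \<in> zero_at m0" by blast
    define m where "m = (LEAST m. m \<in> G \<inter> {N..R} \<and> \<omega> \<in> zero_at m)"
    have m: "m \<in> G \<inter> {N..R} \<and> \<omega> \<in> zero_at m"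
      unfolding m_def by (rule LeastI) (rule m0)
    have "\<not> (j \<in> G \<inter> {N..R} \<and> \<omega> \<in> zero_at j)" if "j < m" for j
      using not_less_Least[of j] that unfolding m_def by blast
    then have "\<omega> \<in> E m" using m by (fastforce simp: E_def)
    then show "\<omega> \<in> (\<Union>m\<in>G \<inter> {N..R}. E m)" using m by blast
  qed (use E_zero in blast)
  have disj: "disjoint_family_on E (G \<inter> {N..R})"
    unfolding disjoint_family_on_def
  proof (intro ballI impI)
    fix m n assume "m \<in> G \<inter> {N..R}" "n \<in> G \<inter> {N..R}" "m \<noteq> n"
    then show "E m \<inter> E n = {}"
      by (cases "m < n") (auto simp: E_def)
  qed
  \<comment> \<open>A common horizon for all \<open>m \<le> R\<close>, so that the order of
    summation can be exchanged.\<close>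
  define H where "H = Max (insert R (h ` {..R}))"
  have H: "h m \<le> H" if "m \<le> R" for m
    unfolding H_def using that by (intro Max_ge) auto
  have "c * prob (\<Union>m\<in>G \<inter> {N..R}. zero_at m) = (\<Sum>m\<in>G \<inter> {N..R}. c * prob (E m))"
    unfolding E_union using E_events disj
    by (subst finite_measure_finite_Union) (auto simp: sum_distrib_left)
  also have "\<dots> \<le> (\<Sum>m\<in>G \<inter> {N..R}. \<Sum>n=N..H. w n * prob (E m \<inter> zero_at n))"
  proof (intro sum_mono)
    fix m assume m: "m \<in> G \<inter> {N..R}"
    have "c * prob (E m) \<le> (\<Sum>n=m..h m. w n / D_from p m n) * prob (E m)"
      using G m by (intro mult_right_mono) auto
    also have "\<dots> = (\<Sum>n=m..h m. w n * prob (E m \<inter> zero_at n))"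
      unfolding sum_distrib_right
      by (intro sum.cong refl) (simp add: prob_zero_at_from[OF _ E_past E_zero])
    also have "\<dots> \<le> (\<Sum>n=N..H. w n * prob (E m \<inter> zero_at n))"
      using m H[of m] w by (intro sum_mono2) auto
    finally show "c * prob (E m) \<le> (\<Sum>n=N..H. w n * prob (E m \<inter> zero_at n))" .
  qed
  also have "\<dots> = (\<Sum>n=N..H. w n * (\<Sum>m\<in>G \<inter> {N..R}. prob (E m \<inter> zero_at n)))"
    by (subst sum.swap) (simp add: sum_distrib_left)
  also have "\<dots> \<le> (\<Sum>n=N..H. w n * prob (zero_at n))"
  proof (intro sum_mono mult_left_mono w)
    fix n
    have "(\<Sum>m\<in>G \<inter> {N..R}. prob (E m \<inter> zero_at n)) = prob (\<Union>m\<in>G \<inter> {N..R}. E m \<inter> zero_at n)"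
      using E_events disj
      by (subst finite_measure_finite_Union) (auto simp: disjoint_family_on_def)
    also have "\<dots> \<le> prob (zero_at n)"
      by (intro finite_measure_mono) auto
    finally show "(\<Sum>m\<in>G \<inter> {N..R}. prob (E m \<inter> zero_at n)) \<le> prob (zero_at n)" .
  qed
  also have "\<dots> = (\<Sum>n<H + 1 - N. w (n + N) / D p (n + N))"
    by (rule sum.reindex_bij_witness[of _ "\<lambda>n. n + N" "\<lambda>n. n - N"]) (auto simp: prob_zero_at)
  also have "\<dots> \<le> (\<Sum>n. w (n + N) / D p (n + N))"
    using w D_pos sums
    by (intro sum_le_suminf) (auto simp: less_imp_le summable_iff_shift[of "\<lambda>n. w n / D p n"])
  finally show ?thesis .
qed

text \<open>The bound of \<open>prob_zero_in_le\<close> is independent of \<open>R\<close> and is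
  the tail of a convergent series. Letting first \<open>R\<close> and then \<open>N\<close> tend to
  infinity shows that zeros in \<open>G\<close> beyond every \<open>N\<close> have probability
  0.\<close>

lemma finite_zeros_in:
  assumes w: "\<And>n. w n \<ge> 0" and "c > 0"
    and G: "\<And>m. m \<in> G \<Longrightarrow> c \<le> (\<Sum>n=m..h m. w n / D_from p m n)"
    and sums: "summable (\<lambda>n. w n / D p n)"
  shows "AE \<omega> in M. finite {m \<in> G. Z m \<omega> = 0}"
proof -
  define U where "U N = (\<Union>m\<in>G \<inter> {N..}. zero_at m)" for N
  have U_events: "U N \<in> events" for N unfolding U_def by auto
  have "c * prob (U N) \<le> (\<Sum>n. w (n + N) / D p (n + N))" for N
  proof -
    have "(\<lambda>R. prob (\<Union>m\<in>G \<inter> {N..R}. zero_at m)) \<longlonglongrightarrow> prob (\<Union>R. \<Union>m\<in>G \<inter> {N..R}. zero_at m)"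
      by (intro finite_Lim_measure_incseq) (force simp: incseq_def)+
    also have "(\<Union>R. \<Union>m\<in>G \<inter> {N..R}. zero_at m) = U N"
      unfolding U_def by force
    finally show ?thesis
      using prob_zero_in_le[OF w \<open>c > 0\<close> G sums]
      by (intro LIMSEQ_le_const2[OF tendsto_mult_left]) auto
  qed
  moreover have "(\<lambda>N. \<Sum>n. w (n + N) / D p (n + N)) \<longlonglongrightarrow> 0"
    using suminf_exist_split2[OF sums] by simp
  moreover have "(\<lambda>N. c * prob (U N)) \<longlonglongrightarrow> c * prob (\<Inter>N. U N)"
    by (intro tendsto_mult_left finite_Lim_measure_decseq)
      (use U_events in \<open>force simp: decseq_def U_def\<close>)+
  ultimately have "c * prob (\<Inter>N. U N) \<le> 0"
    by (intro LIMSEQ_le[of "\<lambda>N. c * prob (U N)"]) auto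
  then have "prob (\<Inter>N. U N) = 0"
    using \<open>c > 0\<close> by (simp add: mult_le_0_iff order.antisym)
  then have "AE \<omega> in M. \<omega> \<notin> (\<Inter>N. U N)"
    using U_events by (subst (asm) prob_eq_0) auto
  then show ?thesis
  proof (rule AE_mp, intro AE_I2 impI)
    fix \<omega> assume "\<omega> \<in> space M" "\<omega> \<notin> (\<Inter>N. U N)"
    then obtain N where "\<forall>m\<in>G. m \<ge> N \<longrightarrow> Z m \<omega> \<noteq> 0"
      by (auto simp: U_def zero_at_def)
    then have "{m \<in> G. Z m \<omega> = 0} \<subseteq> {..<N}" by force
    then show "finite {m \<in> G. Z m \<omega> = 0}" by (rule finite_subset) simp
  qed
qed

lemma finite_regeneration_times:
  assumes "summable (\<lambda>n. 1 / ln (real n) / D p n)"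
  shows "AE \<omega> in M. finite (regeneration_times Z \<omega>)"
proof -
  have 1: "AE \<omega> in M. finite {m \<in> {m. flat m \<and> m \<ge> 2}. Z m \<omega> = 0}"
  proof (rule finite_zeros_in)
    \<comment> \<open>At 0 and 1 the logarithm is 0 and division by zero gives weight 0.\<close>
    show "1 / ln (real n) \<ge> 0" for n
      by (cases "n = 0") auto
    show "1 / 8 \<le> (\<Sum>n=m..m + window m. 1 / ln (real n) / D_from p m n)"
      if "m \<in> {m. flat m \<and> m \<ge> 2}" for m
      using that by (intro sum_flat_ge) auto
  qed (use assms in auto)
  \<comment> \<open>Flat times are given the empty event, so that only the summable remainder enters
    the Borel--Cantelli lemma.\<close>
  have "AE \<omega> in M. eventually (\<lambda>m. \<omega> \<in> space M - (if flat m then {} else zero_at m)) sequentially"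
  proof (rule borel_cantelli_AE1)
    have "prob (if flat m then {} else zero_at m) = of_bool (\<not> flat m) / D p m" for m
      by (simp add: prob_zero_at)
    then show "summable (\<lambda>m. prob (if flat m then {} else zero_at m))"
      using summable_not_flat by simp
  qed (auto simp: less_top[symmetric])
  with 1 show ?thesis
  proof eventually_elim
    case (elim \<omega>)
    then obtain N where N: "\<And>m. m \<ge> N \<Longrightarrow> \<omega> \<in> space M - (if flat m then {} else zero_at m)"
      by (auto simp: eventually_sequentially)
    have "regeneration_times Z \<omega> \<subseteq> {m \<in> {m. flat m \<and> m \<ge> 2}. Z m \<omega> = 0} \<union> {..<max N 2}"
    proof
      fix m assume "m \<in> regeneration_times Z \<omega>"
      then show "m \<in> {m \<in> {m. flat m \<and> m \<ge> 2}. Z m \<omega> = 0} \<union> {..<max N 2}"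
        using N[of m] by (cases "flat m"; cases "N \<le> m") (auto simp: regeneration_times_def zero_at_def)
    qed
    then show ?case by (rule finite_subset) (use elim(1) in auto)
  qed
qed

end

text \<open>
  A second Borel--Cantelli lemma: Chebyshev's inequality applied to a weighted number of
  occurrences. The correlation constant \<open>1 + \<eta>\<close> may be taken arbitrarily close to 1, which
  makes a zero-one law unnecessary.
\<close>
lemma (in prob_space) weighted_borel_cantelli:
  fixes w :: "nat \<Rightarrow> real"
  assumes A [measurable]: "\<And>n. A n \<in> events" and w: "\<And>n. w n \<ge> 0"
    and div: "\<not> summable (\<lambda>n. w n * prob (A n))"
    and pairs: "\<And>\<eta>. \<eta> > 0 \<Longrightarrow> \<exists>C m0. \<forall>N.
      (\<Sum>m=m0..<N. \<Sum>n=m0..<N. w m * w n * prob (A m \<inter> A n))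
        \<le> (1 + \<eta>) * (\<Sum>m=m0..<N. w m * prob (A m))\<^sup>2 + C * (\<Sum>m=m0..<N. w m * prob (A m))"
  shows "AE \<omega> in M. infinite {n. \<omega> \<in> A n}"
proof -
  define U where "U = {\<omega> \<in> space M. finite {n. \<omega> \<in> A n}}"
  have U_events: "U \<in> events" unfolding U_def by measurable
  have "prob U \<le> 0"
  proof (rule field_le_epsilon)
    fix e :: real assume "e > 0"
    \<comment> \<open>Chebyshev's inequality at distance \<open>\<mu> N / 2\<close> costs a factor
      4, so \<open>\<eta>\<close> contributes \<open>e / 2\<close>; the other half is left for the
      term with \<open>C\<close>.\<close>
    define \<eta> where "\<eta> = e / 8"
    have "\<eta> > 0" using \<open>e > 0\<close> by (simp add: \<eta>_def)
    from pairs[OF this] obtain C m0 where pair: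
      "\<And>N. (\<Sum>m=m0..<N. \<Sum>n=m0..<N. w m * w n * prob (A m \<inter> A n))
        \<le> (1 + \<eta>) * (\<Sum>m=m0..<N. w m * prob (A m))\<^sup>2 + C * (\<Sum>m=m0..<N. w m * prob (A m))"
      by blast
    define X where "X N \<omega> = (\<Sum>n=m0..<N. w n * indicator (A n) \<omega>)" for N \<omega>
    define \<mu> where "\<mu> N = (\<Sum>n=m0..<N. w n * prob (A n))" for N
    \<comment> \<open>If only finitely many events occur, the total weight is finite, so the outcome
      lies in some \<open>F B\<close>.\<close>
    define F where "F B = {\<omega> \<in> space M. \<forall>N. X N \<omega> \<le> real B}" for B
    have X_meas [measurable]: "X N \<in> borel_measurable M" for N
      unfolding X_def by measurable
    have F_events: "F B \<in> events" for B
      unfolding F_def by measurable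
    have int_A: "integrable M (\<lambda>\<omega>. c * indicator (A n) \<omega>)" for c :: real and n
      by (intro integrable_mult_right integrable_real_indicator) (auto simp: less_top[symmetric])
    have E_X: "expectation (X N) = \<mu> N" for N
      unfolding X_def \<mu>_def using int_A by (subst Bochner_Integration.integral_sum) auto
    have X_sq: "(X N \<omega>)\<^sup>2 = (\<Sum>m=m0..<N. \<Sum>n=m0..<N. (w m * w n) * indicator (A m \<inter> A n) \<omega>)" for N \<omega>
      unfolding X_def power2_eq_square sum_product
      by (intro sum.cong refl) (simp add: indicator_inter_arith)
    have int_AA: "integrable M (\<lambda>\<omega>. c * indicator (A m \<inter> A n) \<omega>)" for c :: real and m n
      by (intro integrable_mult_right integrable_real_indicator) (auto simp: less_top[symmetric])
    have int_sq: "integrable M (\<lambda>\<omega>. (X N \<omega>)\<^sup>2)" for N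
      unfolding X_sq by (intro Bochner_Integration.integrable_sum int_AA)
    have int_X: "integrable M (X N)" for N
      unfolding X_def using int_A by (intro Bochner_Integration.integrable_sum) auto
    have E_sq: "expectation (\<lambda>\<omega>. (X N \<omega>)\<^sup>2)
        = (\<Sum>m=m0..<N. \<Sum>n=m0..<N. w m * w n * prob (A m \<inter> A n))" for N
      unfolding X_sq
      by (simp only: Bochner_Integration.integral_sum Bochner_Integration.integrable_sum int_AA) simp
    have var: "variance (X N) \<le> \<eta> * (\<mu> N)\<^sup>2 + C * \<mu> N" for N
      using pair[of N] int_X[of N] int_sq[of N]
      by (subst variance_eq) (auto simp: E_X E_sq algebra_simps simp flip: \<mu>_def)
    have mu_unbounded: "\<exists>N. \<mu> N \<ge> b" for b
    proof (rule ccontr)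
      assume "\<nexists>N. b \<le> \<mu> N"
      then have *: "\<mu> N \<le> b" for N by (meson linear)
      have "summable (\<lambda>n. w (n + m0) * prob (A (n + m0)))"
      proof (rule summableI_nonneg_bounded)
        fix N
        have "(\<Sum>n<N. w (n + m0) * prob (A (n + m0))) = \<mu> (N + m0)"
          unfolding \<mu>_def
          by (rule sum.reindex_bij_witness[of _ "\<lambda>n. n - m0" "\<lambda>n. n + m0"]) auto
        then show "(\<Sum>n<N. w (n + m0) * prob (A (n + m0))) \<le> b" using *[of "N + m0"] by simp
      qed (use w in auto)
      then have "summable (\<lambda>n. w n * prob (A n))"
        by (rule summable_iff_shift[THEN iffD1])
      with div show False by contradiction
    qed
    have F_le: "prob (F B) \<le> e" for B
    proof -
      \<comment> \<open>With \<open>2 * B \<le> \<mu> N\<close>, the variable \<open>X N\<close> is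
        at least \<open>\<mu> N / 2\<close> below its mean on \<open>F B\<close>; the third bound
        makes the term with \<open>C\<close> small.\<close>
      obtain N where N: "\<mu> N \<ge> max 1 (max (2 * real B) (8 * \<bar>C\<bar> / e))"
        using mu_unbounded by blast
      then have mu: "\<mu> N \<ge> 1" "real B \<le> \<mu> N / 2" "8 * \<bar>C\<bar> \<le> e * \<mu> N"
        using \<open>e > 0\<close> by (auto simp: field_simps)
      have "F B \<subseteq> {\<omega> \<in> space M. \<mu> N / 2 \<le> \<bar>X N \<omega> - expectation (X N)\<bar>}"
      proof
        fix \<omega> assume "\<omega> \<in> F B"
        then have "\<omega> \<in> space M" "X N \<omega> \<le> real B" by (auto simp: F_def)
        then show "\<omega> \<in> {\<omega> \<in> space M. \<mu> N / 2 \<le> \<bar>X N \<omega> - expectation (X N)\<bar>}"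
          using mu unfolding E_X by auto
      qed
      then have "prob (F B) \<le> prob {\<omega> \<in> space M. \<mu> N / 2 \<le> \<bar>X N \<omega> - expectation (X N)\<bar>}"
        by (intro finite_measure_mono) auto
      also have "\<dots> \<le> variance (X N) / (\<mu> N / 2)\<^sup>2"
        using mu(1) by (intro Chebyshev_inequality int_sq) auto
      also have "\<dots> \<le> e"
      proof -
        have "8 * C * \<mu> N \<le> e * \<mu> N * \<mu> N"
          using mu(1,3) by (intro mult_right_mono) auto
        then have "variance (X N) \<le> e * (\<mu> N / 2)\<^sup>2"
          using var[of N] by (simp add: \<eta>_def power2_eq_square)
        then show ?thesis
          using mu(1) by (simp add: pos_divide_le_eq)
      qed
      finally show ?thesis .
    qed
    have "U \<subseteq> (\<Union>B. F B)"
    proof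
      fix \<omega> assume "\<omega> \<in> U"
      then have \<omega>: "\<omega> \<in> space M" "finite {n. \<omega> \<in> A n}" by (auto simp: U_def)
      have "X N \<omega> \<le> (\<Sum>n | \<omega> \<in> A n. w n)" for N
      proof -
        have "X N \<omega> = (\<Sum>n\<in>{m0..<N} \<inter> {n. \<omega> \<in> A n}. w n)"
          unfolding X_def by (simp add: indicator_def sum.inter_restrict if_distrib cong: if_cong)
        also have "\<dots> \<le> (\<Sum>n | \<omega> \<in> A n. w n)"
          using \<omega>(2) w by (intro sum_mono2) auto
        finally show ?thesis .
      qed
      moreover obtain B :: nat where "(\<Sum>n | \<omega> \<in> A n. w n) \<le> real B"
        using real_arch_simple by blast
      ultimately show "\<omega> \<in> (\<Union>B. F B)"
        using \<omega>(1) by (auto simp: F_def intro: order.trans)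
    qed
    then have "prob U \<le> prob (\<Union>B. F B)"
      using F_events by (intro finite_measure_mono) auto
    \<comment> \<open>The bound \<open>e\<close> is uniform in \<open>B\<close>, hence passes to the
      increasing union.\<close>
    moreover have "(\<lambda>B. prob (F B)) \<longlonglongrightarrow> prob (\<Union>B. F B)"
    proof (rule finite_Lim_measure_incseq)
      show "incseq F" unfolding incseq_def F_def by (auto intro: order.trans)
    qed (use F_events in auto)
    then have "prob (\<Union>B. F B) \<le> e"
      by (rule LIMSEQ_le_const2) (use F_le in auto)
    ultimately show "prob U \<le> 0 + e" by simp
  qed
  then have "prob U = 0" by (simp add: order.antisym)
  then have "AE \<omega> in M. \<omega> \<notin> U"
    using U_events by (subst (asm) prob_eq_0) auto
  then show ?thesis
    by (rule AE_mp) (auto simp: U_def)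
qed

section \<open>Growth estimates for the divergence half\<close>

lemma harm_le_ln: "n \<ge> 1 \<Longrightarrow> harm n \<le> 1 + ln (real n)"
  using decseq_harm_diff_ln[THEN decseqD, of 0 "n - 1"] by (simp add: harm_expand)

context slow_environment
begin

text \<open>Equivalently, the ratio of the partial sums is at least the ratio of the logarithms to
  the power \<open>1 / \<delta>\<close>. One step compares \<open>1 / (k * ln k)\<close>, which
  bounds the increment of \<open>ln (ln k)\<close>, with \<open>\<delta> / D p k\<close>, and
  \<open>1 / D p k\<close> is the relative increment of \<open>inv_mean_sum p\<close>.\<close>

lemma ln_ln_growth:
  assumes "\<delta> > 0" "n0 \<ge> 2" and D: "\<And>n. n \<ge> n0 \<Longrightarrow> D p n \<le> \<delta> * real n * ln (real n)"
    and "n0 \<le> m" "m \<le> n"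
  shows "ln (ln (real n + 1)) - ln (ln (real m + 1))
    \<le> \<delta> * (ln (inv_mean_sum p n) - ln (inv_mean_sum p m))"
  using \<open>m \<le> n\<close>
proof (induction n rule: dec_induct)
  case (step n)
  \<comment> \<open>The shift by 1 in the logarithms makes \<open>k\<close> the index
    \<open>Suc n\<close> at which the bound on \<open>D\<close> is used.\<close>
  define k where "k = real n + 1"
  have k: "k \<ge> 3" using assms(2,4) step.hyps by (simp add: k_def)
  have lnk: "ln k > 0" using k by simp
  let ?T = "inv_mean_sum p"
  have "ln (ln (k + 1)) - ln (ln k) = ln (ln (k + 1) / ln k)"
    using k by (simp add: ln_div)
  also have "\<dots> \<le> ln (k + 1) / ln k - 1"
    using k by (intro ln_le_minus_one) simp
  also have "\<dots> = ln ((k + 1) / k) / ln k"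
    using k by (simp add: ln_div diff_divide_distrib)
  also have "\<dots> \<le> 1 / k / ln k"
  proof (intro divide_right_mono)
    have "ln ((k + 1) / k) \<le> (k + 1) / k - 1" using k by (intro ln_le_minus_one) simp
    also have "\<dots> = 1 / k" using k by (simp add: field_simps)
    finally show "ln ((k + 1) / k) \<le> 1 / k" .
  qed (use lnk in simp)
  also have "\<dots> \<le> \<delta> / D p (Suc n)"
  proof -
    have "\<delta> / (\<delta> * (k * ln k)) \<le> \<delta> / D p (Suc n)"
      using D[of "Suc n"] assms(4) step.hyps D_pos[of "Suc n"] \<open>\<delta> > 0\<close> k lnk
      by (intro divide_left_mono mult_pos_pos) (auto simp: k_def mult.assoc add.commute)
    then show ?thesis using \<open>\<delta> > 0\<close> by simp
  qed
  also have "\<dots> = \<delta> * (1 - ?T n / ?T (Suc n))"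
    using inv_mean_sum_pos[of "Suc n"] inv_mean_pos[of "Suc n"]
    by (simp add: D_eq inv_mean_sum_Suc field_simps)
  also have "\<dots> \<le> \<delta> * (ln (?T (Suc n)) - ln (?T n))"
  proof (intro mult_left_mono)
    have "ln (?T n / ?T (Suc n)) \<le> ?T n / ?T (Suc n) - 1"
      by (intro ln_le_minus_one divide_pos_pos inv_mean_sum_pos)
    then show "1 - ?T n / ?T (Suc n) \<le> ln (?T (Suc n)) - ln (?T n)"
      using inv_mean_sum_pos[of n] inv_mean_sum_pos[of "Suc n"] by (simp add: ln_div)
  qed (use \<open>\<delta> > 0\<close> in simp)
  finally show ?case
    using step.IH by (simp add: k_def algebra_simps)
qed simp

text \<open>By \<open>inv_mean_sum_add_le\<close> the sum up to \<open>m + l\<close> is at most the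
  fraction \<open>\<eta> / (1 + \<eta>)\<close> of the sum up to \<open>n\<close>, so removing it
  costs at most the factor \<open>1 + \<eta>\<close>.\<close>

lemma D_le_D_from:
  assumes "\<eta> > 0" "m + l \<le> n"
    and "(1 + real l) * (1 + 1 / \<eta>) * inv_mean_sum p m \<le> inv_mean_sum p n"
  shows "D p n \<le> (1 + \<eta>) * D_from p (m + l) n"
proof -
  let ?T = "inv_mean_sum p"
  have "(1 + 1 / \<eta>) * ?T (m + l) \<le> (1 + 1 / \<eta>) * ((1 + real l) * ?T m)"
    using \<open>\<eta> > 0\<close> by (intro mult_left_mono inv_mean_sum_add_le) simp
  also have "\<dots> \<le> ?T n" using assms(3) by (simp add: mult_ac)
  finally have "(1 + \<eta>) * ?T (m + l) \<le> \<eta> * ?T n"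
    using \<open>\<eta> > 0\<close> by (simp add: field_simps)
  then have "?T n / inv_mean p n \<le> (1 + \<eta>) * (?T n - ?T (m + l)) / inv_mean p n"
    using inv_mean_pos[of n] by (intro divide_right_mono) (auto simp: algebra_simps)
  also have "\<dots> \<le> (1 + \<eta>) * D_from p (m + l) n"
    using mult_left_mono[OF D_from_ge_diff[OF assms(2)], of "1 + \<eta>"] \<open>\<eta> > 0\<close> by simp
  finally show ?thesis by (simp add: D_eq)
qed

text \<open>The first \<open>l\<close> indices contribute at most 2 each. The others satisfy
  \<open>ln (n + 1) \<le> L * ln (m + 1)\<close>, so their harmonic sum is at most
  \<open>1 + 2 * L * ln m\<close>; the weight, at most \<open>1 / ln m\<close>, makes this
  bounded.\<close>

lemma sum_near_le:
  assumes "m \<ge> 2" "L \<ge> 0"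
  shows "(\<Sum>n=m..<N. 1 / ln (real n) *
      (if n < m + l then 1 else of_bool (ln (real n + 1) \<le> L * ln (real m + 1)) / (real (n - m - l) + 1)))
    \<le> 2 * real l + 2 + 2 * L"
proof -
  have lnm: "ln (real m) \<ge> 1 / 2"
    using ln2_ge_two_thirds ln_le_cancel_iff[of 2 "real m"] assms(1) by linarith
  have ln_inv: "1 / ln (real n) \<le> 1 / ln (real m)" if "n \<ge> m" for n
    using that assms(1) by (intro divide_left_mono mult_pos_pos) auto
  have "m + 1 \<le> m * m" using mult_le_mono1[of 2 m m] assms(1) by linarith
  then have "real m + 1 \<le> real m * real m" by (metis of_nat_1 of_nat_add of_nat_le_iff of_nat_mult)
  then have "ln (real m + 1) \<le> ln (real m * real m)"
    using assms(1) by (subst ln_le_cancel_iff) auto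
  also have "\<dots> = 2 * ln (real m)" using assms(1) by (simp add: ln_mult)
  finally have lnm1: "ln (real m + 1) \<le> 2 * ln (real m)" .
  let ?e = "\<lambda>n. if n < m + l then 1
    else of_bool (ln (real n + 1) \<le> L * ln (real m + 1)) / (real (n - m - l) + 1)"
  define S where "S = {n \<in> {m + l..<N}. ln (real n + 1) \<le> L * ln (real m + 1)}"
  have fin: "finite S" by (simp add: S_def)
  have "(\<Sum>n=m..<N. 1 / ln (real n) * ?e n)
      \<le> (\<Sum>n=m..<N. (if n < m + l then 2 else 0) + 1 / ln (real m) * (if n \<in> S then 1 / (real (n - m - l) + 1) else 0))"
  proof (intro sum_mono)
    fix n assume n: "n \<in> {m..<N}"
    have "1 / ln (real m) \<le> 2" using lnm by (simp add: field_simps)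
    moreover have "1 / ln (real n) * (1 / (real (n - m - l) + 1)) \<le> 1 / ln (real m) * (1 / (real (n - m - l) + 1))"
      using n by (intro mult_right_mono ln_inv) auto
    ultimately show "1 / ln (real n) * ?e n \<le> (if n < m + l then 2 else 0)
        + 1 / ln (real m) * (if n \<in> S then 1 / (real (n - m - l) + 1) else 0)"
      using n ln_inv[of n]
      by (cases "n < m + l"; cases "n \<in> S") (simp_all add: S_def)
  qed
  also have "\<dots> = 2 * real (card {n\<in>{m..<N}. n < m + l})
      + 1 / ln (real m) * (\<Sum>n\<in>{m..<N} \<inter> S. 1 / (real (n - m - l) + 1))"
    by (simp only: sum.distrib sum_distrib_left[symmetric] sum.inter_restrict[symmetric] finite_atLeastLessThan)
      (simp add: sum.If_cases Int_def)
  also have "{m..<N} \<inter> S = S" by (auto simp: S_def)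
  also have "2 * real (card {n\<in>{m..<N}. n < m + l}) + 1 / ln (real m) * (\<Sum>n\<in>S. 1 / (real (n - m - l) + 1))
      \<le> 2 * real l + 1 / ln (real m) * (1 + L * (2 * ln (real m)))"
  proof (intro add_mono mult_left_mono)
    have "card {n\<in>{m..<N}. n < m + l} \<le> card {m..<m + l}"
      by (intro card_mono) auto
    then show "real (card {n\<in>{m..<N}. n < m + l}) \<le> real l" by simp
    show "(\<Sum>n\<in>S. 1 / (real (n - m - l) + 1)) \<le> 1 + L * (2 * ln (real m))"
    proof (cases "S = {}")
      case False
      define K where "K = Max S"
      have K: "K \<in> S" "\<And>n. n \<in> S \<Longrightarrow> n \<le> K" using fin False by (auto simp: K_def)
      have "(\<Sum>n\<in>S. 1 / (real (n - m - l) + 1)) \<le> (\<Sum>n=m + l..K. 1 / (real (n - m - l) + 1))"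
        using K(2) by (intro sum_mono2) (auto simp: S_def)
      also have "\<dots> = (\<Sum>k<K + 1 - (m + l). inverse (real (Suc k)))"
        by (rule sum.reindex_bij_witness[of _ "\<lambda>k. k + (m + l)" "\<lambda>n. n - (m + l)"])
          (auto simp: field_simps)
      also have "\<dots> = harm (K + 1 - (m + l))" by (simp add: harm_altdef)
      also have "\<dots> \<le> harm (K + 1)" by (intro harm_mono) simp
      also have "\<dots> \<le> 1 + ln (real (K + 1))" by (intro harm_le_ln) simp
      also have "\<dots> \<le> 1 + L * ln (real m + 1)" using K(1) by (simp add: S_def add.commute)
      also have "\<dots> \<le> 1 + L * (2 * ln (real m))"
        using lnm1 \<open>L \<ge> 0\<close> by (intro add_left_mono mult_left_mono)
      finally show ?thesis .
    qed (use lnm \<open>L \<ge> 0\<close> in simp)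
  qed (use lnm in auto)
  also have "\<dots> \<le> 2 * real l + 2 + 2 * L"
    using lnm by (simp add: field_simps)
  finally show ?thesis .
qed

end

section \<open>The divergence half: blocks of zeros and their correlations\<close>

context branching_immigration
begin

definition zeros_at :: "nat \<Rightarrow> nat \<Rightarrow> 'a set" where
  "zeros_at k n = {\<omega> \<in> space M. \<forall>i<k. Z (n + i) \<omega> = 0}"

lemma zeros_at_Suc: "zeros_at (Suc k) n = zero_at n \<inter> zeros_at k (Suc n)"
  by (auto simp: zeros_at_def zero_at_def less_Suc_eq_0_disj)

text \<open>The block ends at time \<open>n + l\<close>, and \<open>past_algebra\<close> contains
  strictly earlier times only, whence the outer \<open>Suc\<close>.\<close>

lemma zeros_at_past: "zeros_at (Suc l) n \<in> sets (past_algebra M Z (Suc (n + l)))"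
proof -
  have "zeros_at (Suc l) n = (\<Inter>i\<in>{..<Suc l}. zero_at (n + i))"
    by (auto simp: zeros_at_def zero_at_def)
  then show ?thesis
    by (auto intro!: sets.finite_INT zero_at_past simp del: lessThan_Suc)
qed

lemma zeros_at_subset: "i \<le> l \<Longrightarrow> zeros_at (Suc l) n \<subseteq> zero_at (n + i)"
  by (auto simp: zeros_at_def zero_at_def)

text \<open>From a zero at \<open>n\<close> the next value is 0 with probability
  \<open>1 / D_from p n (Suc n) = p (Suc n)\<close>; in the induction each new zero is absorbed into
  \<open>E\<close>.\<close>

lemma prob_zeros_at_from:
  assumes "E \<in> sets (past_algebra M Z (Suc n))" "E \<subseteq> zero_at n"
  shows "prob (E \<inter> zeros_at l (Suc n)) = prob E * (\<Prod>i<l. p (Suc n + i))"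
  using assms
proof (induction l arbitrary: E n)
  case 0
  have "E \<inter> zeros_at 0 (Suc n) = E" using past_events[OF 0(1)] sets.sets_into_space by (auto simp: zeros_at_def)
  then show ?case by simp
next
  case (Suc l)
  have p: "p (Suc n) > 0" using p_range[of "Suc n"] by simp
  have "prob (E \<inter> zeros_at (Suc l) (Suc n)) = prob ((E \<inter> zero_at (Suc n)) \<inter> zeros_at l (Suc (Suc n)))"
    by (simp add: zeros_at_Suc Int_assoc)
  also have "\<dots> = prob (E \<inter> zero_at (Suc n)) * (\<Prod>i<l. p (Suc (Suc n) + i))"
  proof (rule Suc.IH)
    show "E \<inter> zero_at (Suc n) \<in> sets (past_algebra M Z (Suc (Suc n)))"
      using Suc.prems(1) past_mono[of "Suc n" "Suc (Suc n)"] by (auto intro!: sets.Int zero_at_past)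
  qed simp
  also have "prob (E \<inter> zero_at (Suc n)) = prob E / D_from p n (Suc n)"
    by (rule prob_zero_at_from) (use Suc.prems in auto)
  also have "D_from p n (Suc n) = 1 / p (Suc n)"
    using p by (simp add: D_from_Suc D_from_self offspring_mean_def field_simps)
  finally show ?case by (simp add: prod.lessThan_Suc_shift del: prod.lessThan_Suc)
qed

lemma prob_zeros_at: "prob (zeros_at (Suc l) n) = (\<Prod>i<l. p (Suc n + i)) / D p n"
  using prob_zeros_at_from[of "zero_at n" n l] by (simp add: zeros_at_Suc zero_at_past prob_zero_at)

text \<open>The first block ends with a zero at \<open>m + l\<close>, from which the process starts
  afresh.\<close>

lemma prob_zeros_at_pair:
  assumes "m + l \<le> n"
  shows "prob (zeros_at (Suc l) m \<inter> zeros_at (Suc l) n)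
    = prob (zeros_at (Suc l) m) * (\<Prod>i<l. p (Suc n + i)) / D_from p (m + l) n"
proof -
  let ?E = "zeros_at (Suc l) m \<inter> zero_at n"
  have "zeros_at (Suc l) m \<in> sets (past_algebra M Z (Suc n))"
    using zeros_at_past[of l m] past_mono[of "Suc (m + l)" "Suc n"] assms by auto
  then have "prob (?E \<inter> zeros_at l (Suc n)) = prob ?E * (\<Prod>i<l. p (Suc n + i))"
    by (intro prob_zeros_at_from sets.Int zero_at_past) auto
  moreover have "prob ?E = prob (zeros_at (Suc l) m) / D_from p (m + l) n"
    using assms by (intro prob_zero_at_from zeros_at_past zeros_at_subset) auto
  ultimately show ?thesis by (simp add: zeros_at_Suc[of l n] Int_assoc)
qed

text \<open>For \<open>n < m + l\<close> the trivial bound is used, and at moderate distance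
  \<open>D_from_ge\<close>. Once \<open>ln (n + 1)\<close> exceeds \<open>L * ln (m + 1)\<close>,
  the choice of \<open>L\<close> and \<open>ln_ln_growth\<close> make \<open>inv_mean_sum p\<close>
  grow by the factor that \<open>D_le_D_from\<close> requires.\<close>

lemma prob_zeros_at_pair_le:
  assumes "\<delta> > 0" "n0 \<ge> 2" and D: "\<And>n. n \<ge> n0 \<Longrightarrow> D p n \<le> \<delta> * real n * ln (real n)"
    and "\<eta> > 0" and L: "L = exp (\<delta> * ln ((1 + real l) * (1 + 1 / \<eta>)))"
    and "n0 \<le> m" "m \<le> n"
  shows "prob (zeros_at (Suc l) m \<inter> zeros_at (Suc l) n)
    \<le> (1 + \<eta>) * prob (zeros_at (Suc l) m) * prob (zeros_at (Suc l) n)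
      + prob (zeros_at (Suc l) m) * (if n < m + l then 1
          else of_bool (ln (real n + 1) \<le> L * ln (real m + 1)) / (real (n - m - l) + 1))"
    (is "?P \<le> (1 + \<eta>) * ?p m * ?p n + ?p m * ?e")
proof -
  define c where "c = (\<Prod>i<l. p (Suc n + i))"
  have c: "0 \<le> c" "c \<le> 1"
  proof -
    have "0 \<le> p (Suc n + i)" "p (Suc n + i) \<le> 1" for i
      using p_bounds[of "Suc n + i"] by auto
    then show "0 \<le> c" "c \<le> 1"
      unfolding c_def by (blast intro: prod_nonneg prod_le_1)+
  qed
  have zm: "zeros_at (Suc l) m \<in> events" by (rule past_events[OF zeros_at_past])
  consider "n < m + l" | "m + l \<le> n" "ln (real n + 1) \<le> L * ln (real m + 1)"
    | "m + l \<le> n" "ln (real n + 1) > L * ln (real m + 1)" by linarith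
  then show ?thesis
  proof cases
    case 1
    have "?P \<le> ?p m" using zm by (intro finite_measure_mono) auto
    moreover have "(1 + \<eta>) * ?p m * ?p n \<ge> 0" using \<open>\<eta> > 0\<close> by simp
    ultimately show ?thesis using 1 by simp
  next
    case 2
    have "?P = ?p m * (c / D_from p (m + l) n)"
      using prob_zeros_at_pair[OF 2(1)] by (simp add: c_def)
    also have "\<dots> \<le> ?p m * (1 / (real (n - m - l) + 1))"
      using c D_from_ge[OF 2(1)] by (intro mult_left_mono frac_le) (auto simp: diff_diff_left)
    also have "\<dots> \<le> (1 + \<eta>) * ?p m * ?p n + ?p m * ?e"
      using 2 \<open>\<eta> > 0\<close> by simp
    finally show ?thesis .
  next
    case 3
    let ?K = "(1 + real l) * (1 + 1 / \<eta>)"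
    have K: "?K > 0" using \<open>\<eta> > 0\<close> by (intro mult_pos_pos add_pos_nonneg) auto
    have lnm: "ln (real m + 1) > 0" using assms(2,6) by (intro ln_gt_zero) simp
    have "\<delta> * ln ?K = ln L" by (simp add: L)
    also have "\<dots> = ln (L * ln (real m + 1)) - ln (ln (real m + 1))"
      using lnm by (simp add: L ln_mult)
    also have "\<dots> \<le> ln (ln (real n + 1)) - ln (ln (real m + 1))"
      using 3(2) lnm L by (intro diff_right_mono ln_mono) auto
    also have "\<dots> \<le> \<delta> * (ln (inv_mean_sum p n) - ln (inv_mean_sum p m))"
      by (rule ln_ln_growth[OF assms(1,2) D assms(6,7)])
    finally have "ln ?K \<le> ln (inv_mean_sum p n) - ln (inv_mean_sum p m)"
      using \<open>\<delta> > 0\<close> by simp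
    then have "ln (?K * inv_mean_sum p m) \<le> ln (inv_mean_sum p n)"
      using K inv_mean_sum_pos[of m] by (subst ln_mult_pos) auto
    then have "?K * inv_mean_sum p m \<le> inv_mean_sum p n"
      using K inv_mean_sum_pos by (subst (asm) ln_le_cancel_iff) auto
    then have "D p n \<le> (1 + \<eta>) * D_from p (m + l) n"
      by (rule D_le_D_from[OF \<open>\<eta> > 0\<close> 3(1)])
    then have "1 / D_from p (m + l) n \<le> (1 + \<eta>) / D p n"
      using D_pos[of n] D_from_pos[OF 3(1)] by (simp add: field_simps)
    then have "?p m * c * (1 / D_from p (m + l) n) \<le> ?p m * c * ((1 + \<eta>) / D p n)"
      using c by (intro mult_left_mono) auto
    moreover have "?P = ?p m * c * (1 / D_from p (m + l) n)"
      using prob_zeros_at_pair[OF 3(1)] by (simp add: c_def)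
    moreover have "?p n = c / D p n"
      by (simp add: prob_zeros_at c_def)
    ultimately show ?thesis
      using 3 by (simp add: mult_ac)
  qed
qed

lemma infinite_strong_regeneration_times:
  assumes "\<epsilon> > 0" and p_ge: "\<And>n. n \<ge> 1 \<Longrightarrow> p n \<ge> \<epsilon>"
    and "\<delta> > 0" and D: "eventually (\<lambda>n. D p n \<le> \<delta> * real n * ln (real n)) sequentially"
    and div: "\<not> summable (\<lambda>n. 1 / ln (real n) / D p n)"
    and "k \<ge> 1"
  shows "AE \<omega> in M. infinite (strong_regeneration_times k Z \<omega>)"
proof -
  from D obtain n0' where "\<And>n. n \<ge> n0' \<Longrightarrow> D p n \<le> \<delta> * real n * ln (real n)"
    by (auto simp: eventually_sequentially)
  then obtain n0 where n0: "n0 \<ge> 2" and D0: "\<And>n. n \<ge> n0 \<Longrightarrow> D p n \<le> \<delta> * real n * ln (real n)"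
    by (metis max.cobounded2 max.boundedE)
  obtain l where k: "k = Suc l" using \<open>k \<ge> 1\<close> by (cases k) auto
  define w where "w n = 1 / ln (real n)" for n :: nat
  have w: "w n \<ge> 0" for n by (cases "n = 0") (auto simp: w_def)
  have "AE \<omega> in M. infinite {n. \<omega> \<in> zeros_at (Suc l) n}"
  proof (rule weighted_borel_cantelli)
    show "zeros_at (Suc l) n \<in> events" for n by (rule past_events[OF zeros_at_past])
    \<comment> \<open>The lower bound \<open>\<epsilon>\<close> on \<open>p\<close> makes a block of
      zeros at most a factor \<open>\<epsilon> ^ l\<close> less likely than its first zero, so
      divergence is inherited.\<close>
    show "\<not> summable (\<lambda>n. w n * prob (zeros_at (Suc l) n))"
    proof
      assume sum: "summable (\<lambda>n. w n * prob (zeros_at (Suc l) n))"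
      have "summable (\<lambda>n. 1 / ln (real n) / D p n)"
      proof (rule summable_comparison_test'[where N = 0])
        show "summable (\<lambda>n. w n * prob (zeros_at (Suc l) n) / \<epsilon> ^ l)"
          using sum by (rule summable_divide)
        fix n
        have "(\<Prod>i<l. \<epsilon>) \<le> (\<Prod>i<l. p (Suc n + i))"
          using \<open>\<epsilon> > 0\<close> by (intro prod_mono) (auto intro: p_ge)
        then have "w n / D p n * \<epsilon> ^ l \<le> w n / D p n * (\<Prod>i<l. p (Suc n + i))"
          using w[of n] D_pos[of n] by (intro mult_left_mono) auto
        then have "w n / D p n \<le> w n / D p n * (\<Prod>i<l. p (Suc n + i)) / \<epsilon> ^ l"
          using \<open>\<epsilon> > 0\<close> by (subst pos_le_divide_eq) auto
        then show "norm (1 / ln (real n) / D p n) \<le> w n * prob (zeros_at (Suc l) n) / \<epsilon> ^ l"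
          using w[of n] D_pos[of n] by (simp add: prob_zeros_at w_def)
      qed
      with div show False by contradiction
    qed
    fix \<eta> :: real assume "\<eta> > 0"
    define L where "L = exp (\<delta> * ln ((1 + real l) * (1 + 1 / \<eta>)))"
    define P where "P n = prob (zeros_at (Suc l) n)" for n
    define PP where "PP m n = prob (zeros_at (Suc l) m \<inter> zeros_at (Suc l) n)" for m n
    define e where "e m n = (if n < m + l then 1
      else of_bool (ln (real n + 1) \<le> L * ln (real m + 1)) / (real (n - m - l) + 1))" for m n
    \<comment> \<open>The error term is kept for \<open>m \<le> n\<close> only; the pairs in the
      other order are handled by symmetry, which doubles the constant \<open>B\<close>.\<close>
    define g where "g m n = of_bool (m \<le> n) * (w m * P m * (w n * e m n))" for m n
    have P: "P n \<ge> 0" for n by (simp add: P_def)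
    have g: "g m n \<ge> 0" for m n
      using w P by (auto simp: g_def e_def intro!: mult_nonneg_nonneg)
    have PP: "w m * w n * PP m n \<le> (1 + \<eta>) * (w m * P m) * (w n * P n) + g m n"
      if "n0 \<le> m" "m \<le> n" for m n
    proof -
      have "PP m n \<le> (1 + \<eta>) * P m * P n + P m * e m n"
        unfolding PP_def P_def e_def
        by (rule prob_zeros_at_pair_le[OF \<open>\<delta> > 0\<close> n0 D0 \<open>\<eta> > 0\<close> L_def that])
      then have "w m * w n * PP m n \<le> w m * w n * ((1 + \<eta>) * P m * P n + P m * e m n)"
        using w by (intro mult_left_mono) auto
      then show ?thesis using that by (simp add: g_def algebra_simps)
    qed
    have PP_sym: "PP m n = PP n m" for m n by (simp add: PP_def Int_commute)
    have PP': "w m * w n * PP m n \<le> (1 + \<eta>) * ((w m * P m) * (w n * P n)) + (g m n + g n m)"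
      if "n0 \<le> m" "n0 \<le> n" for m n
    proof (cases "m \<le> n")
      case True
      then show ?thesis using PP[of m n] that g[of n m] by (simp add: mult.assoc)
    next
      case False
      then show ?thesis using PP[of n m] that g[of m n] by (simp add: PP_sym mult_ac)
    qed
    have g_sum: "(\<Sum>n=n0..<N. g m n) \<le> w m * P m * (2 * real l + 2 + 2 * L)" if "n0 \<le> m" for m N
    proof -
      have "(\<Sum>n=n0..<N. g m n) = (\<Sum>n=m..<N. g m n)"
        using that by (intro sum.mono_neutral_right) (auto simp: g_def)
      also have "\<dots> = w m * P m * (\<Sum>n=m..<N. w n * e m n)"
        unfolding sum_distrib_left by (intro sum.cong) (auto simp: g_def)
      also have "\<dots> \<le> w m * P m * (2 * real l + 2 + 2 * L)"
        unfolding w_def[of "_ :: nat"] e_def using w[of m] P[of m] that n0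
        by (intro mult_left_mono sum_near_le) (auto simp: L_def w_def)
      finally show ?thesis .
    qed
    define B where "B = 2 * real l + 2 + 2 * L"
    have "(\<Sum>m=n0..<N. \<Sum>n=n0..<N. w m * w n * PP m n)
        \<le> (1 + \<eta>) * (\<Sum>m=n0..<N. w m * P m)\<^sup>2 + 2 * B * (\<Sum>m=n0..<N. w m * P m)" for N
    proof -
      have "(\<Sum>m=n0..<N. \<Sum>n=n0..<N. w m * w n * PP m n)
          \<le> (\<Sum>m=n0..<N. \<Sum>n=n0..<N. (1 + \<eta>) * ((w m * P m) * (w n * P n)) + (g m n + g n m))"
        by (intro sum_mono PP') auto
      also have "\<dots> = (1 + \<eta>) * (\<Sum>m=n0..<N. w m * P m)\<^sup>2
          + ((\<Sum>m=n0..<N. \<Sum>n=n0..<N. g m n) + (\<Sum>m=n0..<N. \<Sum>n=n0..<N. g n m))"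
        unfolding power2_eq_square sum_product by (simp only: sum.distrib sum_distrib_left)
      also have "(\<Sum>m=n0..<N. \<Sum>n=n0..<N. g n m) = (\<Sum>m=n0..<N. \<Sum>n=n0..<N. g m n)"
        by (rule sum.swap)
      also have "(\<Sum>m=n0..<N. \<Sum>n=n0..<N. g m n) \<le> (\<Sum>m=n0..<N. w m * P m * B)"
        unfolding B_def by (intro sum_mono g_sum) auto
      also have "\<dots> = B * (\<Sum>m=n0..<N. w m * P m)"
        by (simp add: sum_distrib_left mult.commute)
      finally show ?thesis by simp
    qed
    then show "\<exists>C m0. \<forall>N. (\<Sum>m=m0..<N. \<Sum>n=m0..<N. w m * w n
          * prob (zeros_at (Suc l) m \<inter> zeros_at (Suc l) n))
        \<le> (1 + \<eta>) * (\<Sum>m=m0..<N. w m * prob (zeros_at (Suc l) m))\<^sup>2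
          + C * (\<Sum>m=m0..<N. w m * prob (zeros_at (Suc l) m))"
      unfolding PP_def P_def by blast
  qed (rule w)
  then show ?thesis
  proof (rule AE_mp, intro AE_I2 impI)
    fix \<omega> assume "\<omega> \<in> space M" "infinite {n. \<omega> \<in> zeros_at (Suc l) n}"
    then show "infinite (strong_regeneration_times k Z \<omega>)"
      by (simp add: zeros_at_def strong_regeneration_times_def regeneration_times_def k)
  qed
qed

end

section \<open>Both halves combined\<close>

theorem theorem1:
  fixes M :: "'a measure" and Z :: "nat \<Rightarrow> 'a \<Rightarrow> nat"
    and p r :: "nat \<Rightarrow> real" and \<epsilon> :: real
  assumes "\<epsilon> > 0"
    and "\<And>n. n \<ge> 1 \<Longrightarrow> 0 \<le> r n \<and> r n \<le> 1/2 - \<epsilon>"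
    and "\<And>n. n \<ge> 1 \<Longrightarrow> p n = 1/2 - r n"
    and "branching_immigration M p Z"
  shows "(summable (\<lambda>n. 1 / (D p (n + 2) * ln (real (n + 2)))) \<longrightarrow>
            (AE \<omega> in M. finite (regeneration_times Z \<omega>)))
       \<and> ((\<exists>\<delta>>0. eventually (\<lambda>n. D p n \<le> \<delta> * real n * ln (real n)) sequentially) \<and>
          \<not> summable (\<lambda>n. 1 / (D p (n + 2) * ln (real (n + 2)))) \<longrightarrow>
            (\<forall>k\<ge>1. AE \<omega> in M. infinite (strong_regeneration_times k Z \<omega>)))"
proof -
  interpret branching_immigration M p Z by fact
  \<comment> \<open>Starting the series at 2 or at 0 changes finitely many terms only.\<close>
  have summable_iff: "summable (\<lambda>n. 1 / (D p (n + 2) * ln (real (n + 2))))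
      \<longleftrightarrow> summable (\<lambda>n. 1 / ln (real n) / D p n)"
    using summable_iff_shift[of "\<lambda>n. 1 / ln (real n) / D p n" 2] by (simp add: mult.commute)
  have p_ge: "p n \<ge> \<epsilon>" if "n \<ge> 1" for n
    using assms(2,3)[OF that] by simp
  show ?thesis
    unfolding summable_iff
  proof (intro conjI impI allI)
    assume "summable (\<lambda>n. 1 / ln (real n) / D p n)"
    then show "AE \<omega> in M. finite (regeneration_times Z \<omega>)"
      by (rule finite_regeneration_times)
  next
    fix k :: nat
    assume "(\<exists>\<delta>>0. \<forall>\<^sub>F n in sequentially. D p n \<le> \<delta> * real n * ln (real n))
      \<and> \<not> summable (\<lambda>n. 1 / ln (real n) / D p n)" and "1 \<le> k"
    then show "AE \<omega> in M. infinite (strong_regeneration_times k Z \<omega>)"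
      using infinite_strong_regeneration_times[OF assms(1) p_ge] by blast
  qed
qed

end
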